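(* Let $D$ be a finite set, $M=\mathrm{QoI}(D)$, $\sigma:\mathit{Var}\to M_1$, let $u,w,v_0\in\mathit{Var}$ be distinct, and suppose $\sigma(v_0)\otimes\sigma(v_0)\neq\sigma(v_0)$. Let $C_3=(u:=v_0;\;w:=v_0)$. Then: (1) the bound $\sigma(v_0)$ on the joint observation of $\{u,w\}$ is semantically true: $\pi_{\{u,w\}}\circ\llbracket C_3\rrbracket\circ\hat g:\sigma(v_0)\Rightarrow\mathrm{Id}$ for every mediator family $g$ legal for $\sigma$; (2) it is obtained by specialising the universal typing in the set object: $\alpha_\sigma\bigl(\Delta_{C_3}(u)\otimes\Delta_{C_3}(w)\bigr)=\sigma(v_0)$; (3) every joint bound derivable in the $M$-system is above $\sigma(v_0)\otimes\sigma(v_0)$: if $1\vdash_M\sigma\{C_3\}\Gamma'$ is derivable then $\Gamma'(u)\otimes\Gamma'(w)\sqsupseteq\sigma(v_0)\otimes\sigma(v_0)$.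
   Context: Quantale of information. $D$ is finite. $\mathrm{LoI}(D)$ is the set of equivalence relations on $D$ ordered by $P\sqsubseteq Q$ iff $Q\subseteq P$, so $P\sqcup Q=P\cap Q$, the least element $\mathrm{All}$ is the total relation and the greatest, $\mathrm{Id}$, is equality. For $\mathbb P\subseteq\mathrm{LoI}(D)$, $\mathrm{mix}(\mathbb P)$ is the set of equivalence relations each of whose cells is a cell of some member of $\mathbb P$, and $\mathrm{tc}(\mathbb P)={\downarrow}\mathrm{mix}(\mathbb P)$. $\mathrm{QoI}(D)$ is the set of $\mathbb P$ with $\mathrm{tc}(\mathbb P)=\mathbb P$, ordered by inclusion (written $\sqsubseteq$), with $\bigvee_i\mathbb P_i=\mathrm{tc}(\bigcup_i\mathbb P_i)$, $\mathbb P\otimes\mathbb Q=\mathrm{tc}\{P\sqcup Q\mid P\in\mathbb P,Q\in\mathbb Q\}$, unit $1=\{\mathrm{All}\}$; it is a commutative complete quantale. For a quantale $M$, $M_1=\{m\mid 1\sqsubseteq m\}$, $m^0=1$, $m^n$ is the $n$-fold tensor power, $m^*=\bigvee_{n\ge0}m^n$; empty tensors are $1$. Language. $\mathit{Var}$ is finite; stores are maps $\mathit{Var}\to\mathit{Val}$. Commands: $\mathsf{skip}$, $x:=E$, $C_1;C_2$, $\mathsf{if}\;E\;C_1\;C_2$, $\mathsf{while}\;E\;C$, with the standard semantics $\llbracket C\rrbracket$, a partial function on stores. Expressions (including single variables) evaluate totally, depending only on the variables in $\mathit{fv}(E)$. $\mathit{asgn}(C)$ is the set of variables assigned in $C$.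 $\pi_W$ restricts a store to $W$. Mediators. For a partial function $h$ on $D$ and $\mathbb P\in\mathrm{QoI}(D)$, $h:\mathbb P\Rightarrow\mathrm{Id}$ means: some $P\in\mathbb P$ satisfies $h(d)=h(d')$ whenever $d\,P\,d'$ and both are defined. A mediator family is $g=\langle g_v:D\rightharpoonup\mathit{Val}\rangle_{v\in\mathit{Var}}$ of partial functions with a common domain; $\hat g(d)$ is the store with $v$-component $g_v(d)$. $g$ is legal for $\sigma$ when $g_v:\sigma(v)\Rightarrow\mathrm{Id}$ for every $v$. Set object. $\mathcal U=\mathcal U(\mathit{Var})$ is the set of downsets of $(\mathcal P(\mathit{Var}),\subseteq)$ ordered by inclusion, with $\bigvee=\bigcup$, $\mathbb X\otimes\mathbb Y={\downarrow}\{X\cup Y\mid X\in\mathbb X,Y\in\mathbb Y\}$, $1={\downarrow}\emptyset$; generators $\hat v={\downarrow}\{v\}$. $\alpha_\sigma(\mathbb X)=\bigvee_{X\in\mathbb X}\bigotimes_{v\in X}\sigma(v)$. Typing rules (for each commutative complete quantale $M$). $\Gamma:\mathit{Var}\to M_1$, $p\in M_1$, $t_E(\Gamma)=\bigotimes_{v\in\mathit{fv}(E)}\Gamma(v)$. Derivability $p\vdash_M\Gamma\{C\}\Gamma'$ is generated by: (Skip) $p\vdash\Gamma\{\mathsf{skip}\}\Gamma$. (Assign) $p\vdash\Gamma\{x:=E\}\Gamma[x\mapsto p\otimes t_E(\Gamma)]$. (Seq) from $p\vdash\Gamma\{C_1\}\Gamma''$ and $p\vdash\Gamma''\{C_2\}\Gamma'$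 infer $p\vdash\Gamma\{C_1;C_2\}\Gamma'$. (If) with $t=t_E(\Gamma)$, from $p\otimes t\vdash\Gamma\{C_i\}\Gamma_i'$ ($i=1,2$) infer $p\vdash\Gamma\{\mathsf{if}\;E\;C_1\;C_2\}\Gamma'$ where $\Gamma'(x)=t\otimes(\Gamma_1'(x)\vee\Gamma_2'(x))$ for $x\in\mathit{asgn}(C_1)\cup\mathit{asgn}(C_2)$ and $\Gamma'(x)=\Gamma(x)$ otherwise. (While) with $t=t_E(\Gamma)$, from $p\otimes t\vdash\Gamma\{C\}\Gamma$ infer $p\vdash\Gamma\{\mathsf{while}\;E\;C\}\Gamma^\dagger$ where $\Gamma^\dagger(x)=t^*\otimes\Gamma(x)$ for $x\in\mathit{asgn}(C)$ and $\Gamma^\dagger(x)=\Gamma(x)$ otherwise. (Sub) from $p\vdash\Gamma\{C\}\Gamma_1'$, $p'\sqsubseteq p$, $\Gamma'\sqsubseteq\Gamma$, $\Gamma_1'\sqsubseteq\Gamma_2'$ infer $p'\vdash\Gamma'\{C\}\Gamma_2'$. Algorithmic system. $\mathcal A^C_M(p,\Gamma)$ is defined by recursion on $C$; the clauses relevant to $C_3$ are $\mathcal A^{x:=E}_M(p,\Gamma)=\Gamma[x\mapsto p\otimes t_E(\Gamma)]$ and $\mathcal A^{C_1;C_2}_M(p,\Gamma)=\mathcal A^{C_2}_M(p,\mathcal A^{C_1}_M(p,\Gamma))$. $\Delta_C=\mathcal A^C_{\mathcal U}(1,\Delta_0)$ with $\Delta_0(v)=\hat v$. *)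

theory Defs
  imports "HOL-Library.FuncSet"
begin

section \<open>Commutative complete quantales\<close>

text \<open>The tensor is written \<open>*\<close>, its unit \<open>1\<close>; finite tensors and tensor powers are
  therefore \<^const>\<open>prod\<close> and \<^const>\<open>power\<close>, and the order is \<open>\<le>\<close>.\<close>

class comm_quantale = complete_lattice + comm_monoid_mult +
  assumes mult_Sup_distrib: "a * Sup A = (SUP b\<in>A. a * b)"

text \<open>\<open>M\<^sub>1\<close>\<close>

definition above_one :: "'m::comm_quantale set" where
  "above_one = {m. 1 \<le> m}"

definition star :: "'m::comm_quantale \<Rightarrow> 'm" where
  "star m = (SUP n. m ^ n)"


section \<open>The quantale of information\<close>

text \<open>The set \<open>D\<close> is the universe of the type \<open>'d\<close>. The information order on
  \<open>LoI\<close> is reverse inclusion, so the join of two relations is their intersection, the least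
  relation is \<^term>\<open>UNIV\<close> and the greatest is \<^term>\<open>Id\<close>.\<close>

definition LoI :: "'d rel set" where
  "LoI = {R. equiv UNIV R}"

definition mix :: "'d rel set \<Rightarrow> 'd rel set" where
  "mix \<PP> = {R \<in> LoI. \<forall>c \<in> UNIV // R. \<exists>P\<in>\<PP>. c \<in> UNIV // P}"

definition loi_down :: "'d rel set \<Rightarrow> 'd rel set" where
  "loi_down \<PP> = {R \<in> LoI. \<exists>Q\<in>\<PP>. Q \<subseteq> R}"

definition tc :: "'d rel set \<Rightarrow> 'd rel set" where
  "tc \<PP> = loi_down (mix \<PP>)"

definition joins :: "'d rel set \<Rightarrow> 'd rel set \<Rightarrow> 'd rel set" where
  "joins \<PP> \<QQ> = {P \<inter> Q | P Q. P \<in> \<PP> \<and> Q \<in> \<QQ>}"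

lemma LoI_class_eq:
  assumes "P \<in> LoI" "c \<in> UNIV // P" "x \<in> c"
  shows "c = P `` {x}"
proof -
  from assms obtain y where y: "c = P `` {y}" by (auto elim: quotientE)
  with assms have "(y, x) \<in> P" by auto
  then show ?thesis using y assms(1) unfolding LoI_def
    by (metis equiv_class_eq mem_Collect_eq)
qed

lemma LoI_self: "P \<in> LoI \<Longrightarrow> x \<in> P `` {x}"
  by (auto simp: LoI_def equiv_def refl_on_def)

lemma mix_iff:
  assumes "\<PP> \<subseteq> LoI"
  shows "R \<in> mix \<PP> \<longleftrightarrow> R \<in> LoI \<and> (\<forall>x. \<exists>P\<in>\<PP>. R `` {x} = P `` {x})"
proof
  assume R: "R \<in> mix \<PP>"
  then have L: "R \<in> LoI" by (simp add: mix_def)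
  have "\<exists>P\<in>\<PP>. R `` {x} = P `` {x}" for x
  proof -
    have "R `` {x} \<in> UNIV // R" by (auto simp: quotient_def)
    with R obtain P where "P \<in> \<PP>" "R `` {x} \<in> UNIV // P" by (auto simp: mix_def)
    with LoI_class_eq[of P "R `` {x}" x] LoI_self[OF L, of x] assms show ?thesis by blast
  qed
  with L show "R \<in> LoI \<and> (\<forall>x. \<exists>P\<in>\<PP>. R `` {x} = P `` {x})" by blast
next
  assume R: "R \<in> LoI \<and> (\<forall>x. \<exists>P\<in>\<PP>. R `` {x} = P `` {x})"
  have "\<exists>P\<in>\<PP>. c \<in> UNIV // P" if c: "c \<in> UNIV // R" for c
  proof -
    from c obtain x where "c = R `` {x}" by (auto elim: quotientE)
    moreover from R obtain P where "P \<in> \<PP>" "R `` {x} = P `` {x}" by blast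
    ultimately show ?thesis by (auto simp: quotient_def)
  qed
  with R show "R \<in> mix \<PP>" by (auto simp: mix_def)
qed

lemma mix_subset_LoI: "mix \<PP> \<subseteq> LoI" by (auto simp: mix_def)

lemma tc_subset_LoI: "tc \<PP> \<subseteq> LoI" by (auto simp: tc_def loi_down_def)

lemma tc_iff: "R \<in> tc \<PP> \<longleftrightarrow> R \<in> LoI \<and> (\<exists>Q\<in>mix \<PP>. Q \<subseteq> R)"
  by (simp add: tc_def loi_down_def)

lemma mix_mono: "\<PP> \<subseteq> \<QQ> \<Longrightarrow> mix \<PP> \<subseteq> mix \<QQ>"
  unfolding mix_def by fast

lemma tc_mono: "\<PP> \<subseteq> \<QQ> \<Longrightarrow> tc \<PP> \<subseteq> tc \<QQ>"
  using mix_mono[of \<PP> \<QQ>] unfolding tc_def loi_down_def by blast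

lemma tc_extensive:
  assumes "\<PP> \<subseteq> LoI" shows "\<PP> \<subseteq> tc \<PP>"
proof
  fix R assume "R \<in> \<PP>"
  then have "R \<in> mix \<PP>" unfolding mix_iff[OF assms] using assms by auto
  then show "R \<in> tc \<PP>" using assms \<open>R \<in> \<PP>\<close> by (auto simp: tc_iff)
qed

lemma tc_idem:
  assumes PL: "\<PP> \<subseteq> LoI"
  shows "tc (tc \<PP>) = tc \<PP>"
proof
  show "tc (tc \<PP>) \<subseteq> tc \<PP>"
  proof
    fix R assume "R \<in> tc (tc \<PP>)"
    then obtain Q where R: "R \<in> LoI" and Q: "Q \<in> mix (tc \<PP>)" and QR: "Q \<subseteq> R"
      by (auto simp: tc_iff)
    have QL: "Q \<in> LoI" using Q mix_subset_LoI by blast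
    then have Qeq: "equiv UNIV Q" by (simp add: LoI_def)
    have ex: "\<exists>K. K \<in> mix \<PP> \<and> K `` {x} \<subseteq> c \<and> (\<forall>y\<in>c. K `` {y} \<subseteq> c)"
      if "c = Q `` {x}" for c x
    proof -
      have "c \<in> UNIV // Q" using that by (auto simp: quotient_def)
      then obtain P where P: "P \<in> tc \<PP>" "c \<in> UNIV // P" using Q by (auto simp: mix_def)
      then obtain K where K: "K \<in> mix \<PP>" "K \<subseteq> P" by (auto simp: tc_iff)
      have "P \<in> LoI" using P(1) tc_subset_LoI by blast
      then have "K `` {y} \<subseteq> c" if "y \<in> c" for y
        using LoI_class_eq[of P c y] P(2) that K(2) by auto
      then show ?thesis using K(1) LoI_self[OF QL, of x] that by auto
    qed
    define K where "K c = (SOME K. K \<in> mix \<PP> \<and> (\<forall>y\<in>c. K `` {y} \<subseteq> c))" for c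
    have K: "K (Q `` {x}) \<in> mix \<PP>" "\<And>y. y \<in> Q `` {x} \<Longrightarrow> K (Q `` {x}) `` {y} \<subseteq> Q `` {x}" for x
      using someI_ex[of "\<lambda>K. K \<in> mix \<PP> \<and> (\<forall>y\<in>Q `` {x}. K `` {y} \<subseteq> Q `` {x})"] ex[OF refl, of x]
      unfolding K_def by blast+
    have KL: "equiv UNIV (K (Q `` {x}))" for x
      using K(1)[of x] mix_subset_LoI unfolding LoI_def by blast
    define S where "S = {(x, y). (x, y) \<in> K (Q `` {x})}"
    have S_im: "S `` {x} = K (Q `` {x}) `` {x}" for x by (auto simp: S_def)
    have SQ: "S \<subseteq> Q"
      using K(2) LoI_self[OF QL] unfolding S_def by blast
    have cls: "Q `` {x} = Q `` {y}" if "(x, y) \<in> S" for x y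
      using that SQ Qeq by (meson equiv_class_eq subsetD)
    have "equiv UNIV S"
    proof (rule equivI)
      show "refl S"
        using KL by (auto simp: S_def refl_on_def equiv_def)
      show "sym S"
      proof (rule symI)
        fix x y assume xy: "(x, y) \<in> S"
        then have "(y, x) \<in> K (Q `` {x})" using KL[of x]
          by (auto simp: S_def equiv_def sym_def)
        then show "(y, x) \<in> S" using cls[OF xy] by (simp add: S_def)
      qed
      show "trans S"
      proof (rule transI)
        fix x y z assume xy: "(x, y) \<in> S" and yz: "(y, z) \<in> S"
        then have "(x, y) \<in> K (Q `` {x})" "(y, z) \<in> K (Q `` {x})"
          using cls[OF xy] by (auto simp: S_def)
        then show "(x, z) \<in> S" using KL[of x] unfolding S_def equiv_def trans_def by blast
      qed
    qed simp
    then have SL: "S \<in> LoI" by (simp add: LoI_def)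
    have "\<exists>P\<in>\<PP>. S `` {x} = P `` {x}" for x
      using K(1)[of x] PL by (auto simp: S_im mix_iff)
    then have "S \<in> mix \<PP>" using SL PL by (simp add: mix_iff)
    then show "R \<in> tc \<PP>" using R QR SQ by (auto simp: tc_iff)
  qed
  show "tc \<PP> \<subseteq> tc (tc \<PP>)" by (rule tc_extensive[OF tc_subset_LoI])
qed

lemma tc_subset_iff:
  assumes "\<PP> \<subseteq> LoI" "\<QQ> \<subseteq> LoI" shows "tc \<PP> \<subseteq> tc \<QQ> \<longleftrightarrow> \<PP> \<subseteq> tc \<QQ>"
  by (metis assms order_trans tc_extensive tc_idem tc_mono)

lemma LoI_Int: "P \<in> LoI \<Longrightarrow> Q \<in> LoI \<Longrightarrow> P \<inter> Q \<in> LoI"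
  unfolding LoI_def equiv_def refl_on_def sym_def trans_def by blast

lemma joins_LoI: "\<PP> \<subseteq> LoI \<Longrightarrow> \<QQ> \<subseteq> LoI \<Longrightarrow> joins \<PP> \<QQ> \<subseteq> LoI"
  unfolding joins_def using LoI_Int by blast

lemma joins_commute: "joins \<PP> \<QQ> = joins \<QQ> \<PP>"
  unfolding joins_def by blast

lemma joins_mono: "\<PP> \<subseteq> \<PP>' \<Longrightarrow> \<QQ> \<subseteq> \<QQ>' \<Longrightarrow> joins \<PP> \<QQ> \<subseteq> joins \<PP>' \<QQ>'"
  unfolding joins_def by blast

lemma joins_assoc: "joins (joins \<PP> \<QQ>) \<RR> = joins \<PP> (joins \<QQ> \<RR>)"
proof -
  have "joins (joins \<PP> \<QQ>) \<RR> = {P \<inter> Q \<inter> R | P Q R. P \<in> \<PP> \<and> Q \<in> \<QQ> \<and> R \<in> \<RR>}"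
    unfolding joins_def by blast
  also have "\<dots> = joins \<PP> (joins \<QQ> \<RR>)"
    unfolding joins_def Int_assoc by blast
  finally show ?thesis .
qed

lemma tc_joins_tc:
  assumes P: "\<PP> \<subseteq> LoI" and Q: "\<QQ> \<subseteq> LoI"
  shows "tc (joins \<PP> (tc \<QQ>)) = tc (joins \<PP> \<QQ>)"
proof
  have "joins \<PP> (tc \<QQ>) \<subseteq> tc (joins \<PP> \<QQ>)"
  proof
    fix S assume "S \<in> joins \<PP> (tc \<QQ>)"
    then obtain A R where S: "S = A \<inter> R" "A \<in> \<PP>" "R \<in> tc \<QQ>" by (auto simp: joins_def)
    then obtain B where B: "B \<in> mix \<QQ>" "B \<subseteq> R" and R: "R \<in> LoI" by (auto simp: tc_iff)
    have "A \<in> LoI" "B \<in> LoI" using S P B mix_subset_LoI by blast+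
    then have AB: "A \<inter> B \<in> LoI" "A \<inter> R \<in> LoI" using R LoI_Int by blast+
    have "\<exists>T\<in>joins \<PP> \<QQ>. (A \<inter> B) `` {x} = T `` {x}" for x
    proof -
      obtain B' where "B' \<in> \<QQ>" "B `` {x} = B' `` {x}"
        using B(1) unfolding mix_iff[OF Q] by blast
      then have "A \<inter> B' \<in> joins \<PP> \<QQ>" "(A \<inter> B) `` {x} = (A \<inter> B') `` {x}"
        using S(2) by (auto simp: joins_def)
      then show ?thesis by blast
    qed
    then have "A \<inter> B \<in> mix (joins \<PP> \<QQ>)" using AB joins_LoI[OF P Q] by (simp add: mix_iff)
    then show "S \<in> tc (joins \<PP> \<QQ>)" using S AB B by (auto simp: tc_iff)
  qed
  then show "tc (joins \<PP> (tc \<QQ>)) \<subseteq> tc (joins \<PP> \<QQ>)"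
    by (simp add: P Q joins_LoI tc_subset_LoI tc_subset_iff)
  show "tc (joins \<PP> \<QQ>) \<subseteq> tc (joins \<PP> (tc \<QQ>))"
    by (intro tc_mono joins_mono order_refl tc_extensive Q)
qed

lemma tc_UN_tc:
  assumes "\<And>i. i \<in> I \<Longrightarrow> F i \<subseteq> LoI"
  shows "tc (\<Union>i\<in>I. tc (F i)) = tc (\<Union>i\<in>I. F i)"
proof
  have L: "(\<Union>i\<in>I. F i) \<subseteq> LoI" "(\<Union>i\<in>I. tc (F i)) \<subseteq> LoI"
    using assms tc_subset_LoI by blast+
  have "tc (F i) \<subseteq> tc (\<Union>i\<in>I. F i)" if "i \<in> I" for i
    using that by (intro tc_mono) blast
  then show "tc (\<Union>i\<in>I. tc (F i)) \<subseteq> tc (\<Union>i\<in>I. F i)"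
    by (simp add: tc_subset_iff[OF L(2,1)] UN_subset_iff)
  show "tc (\<Union>i\<in>I. F i) \<subseteq> tc (\<Union>i\<in>I. tc (F i))"
    by (intro tc_mono UN_mono order_refl tc_extensive assms)
qed

lemma UNIV_LoI: "UNIV \<in> LoI"
  by (auto simp: LoI_def equiv_def refl_on_def sym_def trans_def)

lemma tc_All: "tc {UNIV} = {UNIV}"
proof -
  have "R = UNIV" if "R \<in> tc {UNIV}" for R :: "'a rel"
  proof -
    from that obtain Q where "Q \<in> mix {UNIV}" "Q \<subseteq> R" by (auto simp: tc_iff)
    have "{UNIV} \<subseteq> (LoI :: 'a rel set)" using UNIV_LoI by simp
    from mix_iff[OF this, of Q] \<open>Q \<in> mix {UNIV}\<close> have "Q `` {x} = UNIV `` {x}" for x by simp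
    then have "Q = UNIV" by (metis Image_singleton_iff UNIV_I UNIV_eq_I surj_pair)
    with \<open>Q \<subseteq> R\<close> show ?thesis by blast
  qed
  moreover have "{UNIV} \<subseteq> tc {UNIV :: 'a rel}" using UNIV_LoI by (intro tc_extensive) auto
  ultimately show ?thesis by blast
qed

typedef 'd qoi = "{\<PP> :: 'd rel set. \<PP> \<subseteq> LoI \<and> tc \<PP> = \<PP>}"
  morphisms relations Abs_qoi
proof -
  have "tc {} \<in> {\<PP> :: 'd rel set. \<PP> \<subseteq> LoI \<and> tc \<PP> = \<PP>}"
    using tc_subset_LoI tc_idem[of "{}"] by auto
  then show ?thesis by blast
qed

setup_lifting type_definition_qoi

lemma relations_LoI: "relations \<PP> \<subseteq> LoI" and tc_relations: "tc (relations \<PP>) = relations \<PP>"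
  using relations[of \<PP>] by auto

instantiation qoi :: (type) comm_quantale
begin

lift_definition less_eq_qoi :: "'a qoi \<Rightarrow> 'a qoi \<Rightarrow> bool" is "(\<subseteq>)" .

definition less_qoi :: "'a qoi \<Rightarrow> 'a qoi \<Rightarrow> bool" where
  "less_qoi \<PP> \<QQ> \<longleftrightarrow> \<PP> \<le> \<QQ> \<and> \<not> \<QQ> \<le> \<PP>"

lift_definition Sup_qoi :: "'a qoi set \<Rightarrow> 'a qoi" is "\<lambda>S. tc (\<Union>S)"
  by (intro conjI tc_subset_LoI tc_idem Union_least) blast

lift_definition sup_qoi :: "'a qoi \<Rightarrow> 'a qoi \<Rightarrow> 'a qoi" is "\<lambda>\<PP> \<QQ>. tc (\<PP> \<union> \<QQ>)"
  by (intro conjI tc_subset_LoI tc_idem) blast+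

lift_definition bot_qoi :: "'a qoi" is "tc {}"
  by (intro conjI tc_subset_LoI tc_idem) blast+

lift_definition Inf_qoi :: "'a qoi set \<Rightarrow> 'a qoi" is "\<lambda>S. LoI \<inter> \<Inter>S"
proof
  fix S :: "'a rel set set"
  assume S: "\<And>\<PP>. \<PP> \<in> S \<Longrightarrow> \<PP> \<subseteq> LoI \<and> tc \<PP> = \<PP>"
  show "LoI \<inter> \<Inter>S \<subseteq> LoI" by blast
  have "tc (LoI \<inter> \<Inter>S) \<subseteq> \<PP>" if "\<PP> \<in> S" for \<PP>
  proof -
    have "tc (LoI \<inter> \<Inter>S) \<subseteq> tc \<PP>" using that by (intro tc_mono) blast
    then show ?thesis using S[OF that] by simp
  qed
  then have "tc (LoI \<inter> \<Inter>S) \<subseteq> LoI \<inter> \<Inter>S" using tc_subset_LoI by (simp add: Inter_greatest)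
  then show "tc (LoI \<inter> \<Inter>S) = LoI \<inter> \<Inter>S"
    by (rule subset_antisym) (rule tc_extensive, blast)
qed

lift_definition inf_qoi :: "'a qoi \<Rightarrow> 'a qoi \<Rightarrow> 'a qoi" is "(\<inter>)"
proof
  fix \<PP> \<QQ> :: "'a rel set"
  assume a: "\<PP> \<subseteq> LoI \<and> tc \<PP> = \<PP>" "\<QQ> \<subseteq> LoI \<and> tc \<QQ> = \<QQ>"
  then show L: "\<PP> \<inter> \<QQ> \<subseteq> LoI" by blast
  have "tc (\<PP> \<inter> \<QQ>) \<subseteq> tc \<PP>" "tc (\<PP> \<inter> \<QQ>) \<subseteq> tc \<QQ>"
    by (simp_all add: tc_mono)
  then have "tc (\<PP> \<inter> \<QQ>) \<subseteq> \<PP> \<inter> \<QQ>" using a by simp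
  then show "tc (\<PP> \<inter> \<QQ>) = \<PP> \<inter> \<QQ>" using tc_extensive[OF L] by (rule subset_antisym)
qed

lift_definition top_qoi :: "'a qoi" is LoI
  by (intro conjI order_refl subset_antisym tc_subset_LoI tc_extensive)

lift_definition one_qoi :: "'a qoi" is "{UNIV}"
  using UNIV_LoI tc_All by blast

lift_definition times_qoi :: "'a qoi \<Rightarrow> 'a qoi \<Rightarrow> 'a qoi" is "\<lambda>\<PP> \<QQ>. tc (joins \<PP> \<QQ>)"
  by (intro conjI tc_subset_LoI tc_idem joins_LoI) blast+

instance
proof
  fix x y z :: "'a qoi" and A :: "'a qoi set"
  show "x < y \<longleftrightarrow> x \<le> y \<and> \<not> y \<le> x" by (simp add: less_qoi_def)
  show "x \<le> x" by transfer simp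
  show "x \<le> y \<Longrightarrow> y \<le> z \<Longrightarrow> x \<le> z" by transfer simp
  show "x \<le> y \<Longrightarrow> y \<le> x \<Longrightarrow> x = y" by transfer simp
  show "inf x y \<le> x" by transfer simp
  show "inf x y \<le> y" by transfer simp
  show "x \<le> y \<Longrightarrow> x \<le> z \<Longrightarrow> x \<le> inf y z" by transfer simp
  show "x \<le> sup x y"
    using tc_extensive[of "relations x \<union> relations y"] relations_LoI[of x] relations_LoI[of y]
    by (simp add: less_eq_qoi.rep_eq sup_qoi.rep_eq)
  show "y \<le> sup x y"
    using tc_extensive[of "relations x \<union> relations y"] relations_LoI[of x] relations_LoI[of y]
    by (simp add: less_eq_qoi.rep_eq sup_qoi.rep_eq)
  show "y \<le> x \<Longrightarrow> z \<le> x \<Longrightarrow> sup y z \<le> x"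
    using tc_mono[of "relations y \<union> relations z" "relations x"]
    by (simp add: less_eq_qoi.rep_eq sup_qoi.rep_eq tc_relations)
  show "x \<in> A \<Longrightarrow> Inf A \<le> x"
    by (auto simp: less_eq_qoi.rep_eq Inf_qoi.rep_eq)
  show "(\<And>x. x \<in> A \<Longrightarrow> z \<le> x) \<Longrightarrow> z \<le> Inf A"
    using relations_LoI[of z] by (simp add: less_eq_qoi.rep_eq Inf_qoi.rep_eq le_INF_iff)
  show "x \<le> Sup A" if "x \<in> A"
  proof -
    have "relations x \<subseteq> (\<Union>y\<in>A. relations y)" using that by blast
    also have "\<dots> \<subseteq> tc \<dots>" by (intro tc_extensive UN_least relations_LoI)
    finally show ?thesis by (simp add: less_eq_qoi.rep_eq Sup_qoi.rep_eq)
  qed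
  show "Sup A \<le> z" if "\<And>x. x \<in> A \<Longrightarrow> x \<le> z"
    using that tc_mono[of "\<Union>y\<in>A. relations y" "relations z"]
    by (simp add: less_eq_qoi.rep_eq Sup_qoi.rep_eq tc_relations SUP_le_iff)
  show "Inf {} = (top :: 'a qoi)" by transfer simp
  show "Sup {} = (bot :: 'a qoi)" by transfer simp
  show "x * y * z = x * (y * z)"
  proof transfer
    fix \<PP> \<QQ> \<RR> :: "'a rel set"
    assume "\<PP> \<subseteq> LoI \<and> tc \<PP> = \<PP>" "\<QQ> \<subseteq> LoI \<and> tc \<QQ> = \<QQ>" "\<RR> \<subseteq> LoI \<and> tc \<RR> = \<RR>"
    then have L: "\<PP> \<subseteq> LoI" "\<QQ> \<subseteq> LoI" "\<RR> \<subseteq> LoI" by blast+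
    have "tc (joins (tc (joins \<PP> \<QQ>)) \<RR>) = tc (joins \<RR> (joins \<PP> \<QQ>))"
      using tc_joins_tc[OF L(3) joins_LoI[OF L(1,2)]] by (simp add: joins_commute)
    also have "joins \<RR> (joins \<PP> \<QQ>) = joins \<PP> (joins \<QQ> \<RR>)"
      using joins_assoc[of \<PP> \<QQ> \<RR>] joins_commute[of \<RR> "joins \<PP> \<QQ>"] by simp
    also have "tc \<dots> = tc (joins \<PP> (tc (joins \<QQ> \<RR>)))"
      using tc_joins_tc[OF L(1) joins_LoI[OF L(2,3)]] by simp
    finally show "tc (joins (tc (joins \<PP> \<QQ>)) \<RR>) = tc (joins \<PP> (tc (joins \<QQ> \<RR>)))" .
  qed
  show "x * y = y * x" by transfer (simp add: joins_commute)
  show "1 * x = x" by transfer (simp add: joins_def)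
  show "x * Sup A = (SUP b\<in>A. x * b)"
  proof -
    let ?U = "\<Union>b\<in>A. relations b"
    have "tc (joins (relations x) (tc ?U)) = tc (joins (relations x) ?U)"
      by (intro tc_joins_tc UN_least relations_LoI)
    also have "joins (relations x) ?U = (\<Union>b\<in>A. joins (relations x) (relations b))"
      by (auto simp: joins_def)
    also have "tc \<dots> = tc (\<Union>b\<in>A. tc (joins (relations x) (relations b)))"
      by (intro tc_UN_tc[symmetric] joins_LoI relations_LoI)
    finally have "relations (x * Sup A) = relations (SUP b\<in>A. x * b)"
      by (simp add: times_qoi.rep_eq Sup_qoi.rep_eq image_image)
    then show ?thesis by (simp add: relations_inject)
  qed
qed

end


section \<open>The set object\<close>

definition down :: "'v set set \<Rightarrow> 'v set set" where
  "down \<XX> = {Y. \<exists>X\<in>\<XX>. Y \<subseteq> X}"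

lemma down_closed: "X \<in> down \<XX> \<Longrightarrow> Y \<subseteq> X \<Longrightarrow> Y \<in> down \<XX>"
  unfolding down_def by blast

typedef 'v downset = "{\<XX> :: 'v set set. \<forall>X\<in>\<XX>. \<forall>Y. Y \<subseteq> X \<longrightarrow> Y \<in> \<XX>}"
  morphisms members Abs_downset
  by blast

setup_lifting type_definition_downset

instantiation downset :: (type) comm_quantale
begin

lift_definition less_eq_downset :: "'a downset \<Rightarrow> 'a downset \<Rightarrow> bool" is "(\<subseteq>)" .

definition less_downset :: "'a downset \<Rightarrow> 'a downset \<Rightarrow> bool" where
  "less_downset \<XX> \<YY> \<longleftrightarrow> \<XX> \<le> \<YY> \<and> \<not> \<YY> \<le> \<XX>"

lift_definition Sup_downset :: "'a downset set \<Rightarrow> 'a downset" is "Union" by blast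

lift_definition sup_downset :: "'a downset \<Rightarrow> 'a downset \<Rightarrow> 'a downset" is "(\<union>)" by blast

lift_definition bot_downset :: "'a downset" is "{}" by blast

lift_definition Inf_downset :: "'a downset set \<Rightarrow> 'a downset" is "Inter" by blast

lift_definition inf_downset :: "'a downset \<Rightarrow> 'a downset \<Rightarrow> 'a downset" is "(\<inter>)" by blast

lift_definition top_downset :: "'a downset" is "UNIV" by blast

lift_definition one_downset :: "'a downset" is "down {{}}"
  by (rule down_closed)

lift_definition times_downset :: "'a downset \<Rightarrow> 'a downset \<Rightarrow> 'a downset" is
  "\<lambda>\<XX> \<YY>. down {X \<union> Y | X Y. X \<in> \<XX> \<and> Y \<in> \<YY>}"
  by (rule down_closed)

instance
proof
  fix x y z :: "'a downset" and A :: "'a downset set"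
  show "x < y \<longleftrightarrow> x \<le> y \<and> \<not> y \<le> x" by (simp add: less_downset_def)
  show "x \<le> x" by transfer simp
  show "x \<le> y \<Longrightarrow> y \<le> z \<Longrightarrow> x \<le> z" by transfer simp
  show "x \<le> y \<Longrightarrow> y \<le> x \<Longrightarrow> x = y" by transfer simp
  show "inf x y \<le> x" by transfer simp
  show "inf x y \<le> y" by transfer simp
  show "x \<le> y \<Longrightarrow> x \<le> z \<Longrightarrow> x \<le> inf y z" by transfer simp
  show "x \<le> sup x y" by transfer simp
  show "y \<le> sup x y" by transfer simp
  show "y \<le> x \<Longrightarrow> z \<le> x \<Longrightarrow> sup y z \<le> x" by transfer simp
  show "x \<in> A \<Longrightarrow> Inf A \<le> x"
    by (auto simp: less_eq_downset.rep_eq Inf_downset.rep_eq)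
  show "(\<And>x. x \<in> A \<Longrightarrow> z \<le> x) \<Longrightarrow> z \<le> Inf A"
    by (auto simp: less_eq_downset.rep_eq Inf_downset.rep_eq)
  show "x \<in> A \<Longrightarrow> x \<le> Sup A"
    by (auto simp: less_eq_downset.rep_eq Sup_downset.rep_eq)
  show "(\<And>x. x \<in> A \<Longrightarrow> x \<le> z) \<Longrightarrow> Sup A \<le> z"
    by (auto simp: less_eq_downset.rep_eq Sup_downset.rep_eq)
  show "Inf {} = (top :: 'a downset)" by transfer simp
  show "Sup {} = (bot :: 'a downset)" by transfer simp
  show "x * y * z = x * (y * z)"
  proof transfer
    fix A B C :: "'a set set"
    have "down {X \<union> Y |X Y. X \<in> down {X \<union> Y |X Y. X \<in> A \<and> Y \<in> B} \<and> Y \<in> C}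
        = down {X \<union> Y \<union> Z |X Y Z. X \<in> A \<and> Y \<in> B \<and> Z \<in> C}"
      unfolding down_def by (auto; blast)
    moreover have "down {X \<union> Y |X Y. X \<in> A \<and> Y \<in> down {X \<union> Y |X Y. X \<in> B \<and> Y \<in> C}}
        = down {X \<union> Y \<union> Z |X Y Z. X \<in> A \<and> Y \<in> B \<and> Z \<in> C}"
      unfolding down_def by (auto; blast)
    ultimately show "down {X \<union> Y |X Y. X \<in> down {X \<union> Y |X Y. X \<in> A \<and> Y \<in> B} \<and> Y \<in> C}
        = down {X \<union> Y |X Y. X \<in> A \<and> Y \<in> down {X \<union> Y |X Y. X \<in> B \<and> Y \<in> C}}" by simp
  qed
  show "x * y = y * x" by transfer (metis (mono_tags, opaque_lifting) Un_commute)
  show "1 * x = x" by transfer (auto simp: down_def)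
  show "x * Sup A = (SUP b\<in>A. x * b)"
    by (simp add: members_inject[symmetric] times_downset.rep_eq Sup_downset.rep_eq image_image)
      (auto simp: down_def)
qed

end

lift_definition gen :: "'v \<Rightarrow> 'v downset" is "\<lambda>v. down {{v}}"
  by (rule down_closed)

definition specialise :: "('v::finite \<Rightarrow> 'm::comm_quantale) \<Rightarrow> 'v downset \<Rightarrow> 'm" where
  "specialise \<sigma> \<XX> = (SUP X\<in>members \<XX>. \<Prod>v\<in>X. \<sigma> v)"


section \<open>The language\<close>

text \<open>The syntax of expressions is left abstract: \<open>eval\<close> is their evaluation, \<open>fv\<close> their
  variables and \<open>var\<close> embeds variables as expressions.\<close>

type_synonym ('v, 'a) store = "'v \<Rightarrow> 'a"

locale expressions =
  fixes eval :: "'e \<Rightarrow> ('v, 'a) store \<Rightarrow> 'a"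
    and fv :: "'e \<Rightarrow> 'v set"
    and var :: "'v \<Rightarrow> 'e"
  assumes eval_cong: "(\<And>v. v \<in> fv E \<Longrightarrow> s v = s' v) \<Longrightarrow> eval E s = eval E s'"
    and eval_var: "eval (var v) s = s v"
    and fv_var: "fv (var v) = {v}"

datatype ('v, 'e) com =
    Skip
  | Assign 'v 'e
  | Seq "('v, 'e) com" "('v, 'e) com"
  | If 'e "('v, 'e) com" "('v, 'e) com"
  | While 'e "('v, 'e) com"

primrec asgn :: "('v, 'e) com \<Rightarrow> 'v set" where
  "asgn Skip = {}"
| "asgn (Assign x E) = {x}"
| "asgn (Seq C\<^sub>1 C\<^sub>2) = asgn C\<^sub>1 \<union> asgn C\<^sub>2"
| "asgn (If E C\<^sub>1 C\<^sub>2) = asgn C\<^sub>1 \<union> asgn C\<^sub>2"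
| "asgn (While E C) = asgn C"

partial_function (option) while_sem :: "('s \<Rightarrow> bool) \<Rightarrow> ('s \<Rightarrow> 's option) \<Rightarrow> 's \<Rightarrow> 's option" where
  "while_sem b f s = (if b s then Option.bind (f s) (while_sem b f) else Some s)"

text \<open>The predicate \<open>tt\<close> says which values count as true in a test.\<close>

primrec sem :: "('e \<Rightarrow> ('v, 'a) store \<Rightarrow> 'a) \<Rightarrow> ('a \<Rightarrow> bool) \<Rightarrow> ('v, 'e) com
    \<Rightarrow> ('v, 'a) store \<Rightarrow> ('v, 'a) store option" where
  "sem eval tt Skip = Some"
| "sem eval tt (Assign x E) = (\<lambda>s. Some (s(x := eval E s)))"
| "sem eval tt (Seq C\<^sub>1 C\<^sub>2) = sem eval tt C\<^sub>2 \<circ>\<^sub>m sem eval tt C\<^sub>1"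
| "sem eval tt (If E C\<^sub>1 C\<^sub>2) =
    (\<lambda>s. if tt (eval E s) then sem eval tt C\<^sub>1 s else sem eval tt C\<^sub>2 s)"
| "sem eval tt (While E C) = while_sem (\<lambda>s. tt (eval E s)) (sem eval tt C)"

definition C3 :: "('v \<Rightarrow> 'e) \<Rightarrow> 'v \<Rightarrow> 'v \<Rightarrow> 'v \<Rightarrow> ('v, 'e) com" where
  "C3 var u w v\<^sub>0 = Seq (Assign u (var v\<^sub>0)) (Assign w (var v\<^sub>0))"


section \<open>Mediators\<close>

definition mediates :: "('d \<rightharpoonup> 'b) \<Rightarrow> 'd qoi \<Rightarrow> bool" where
  "mediates h \<PP> \<longleftrightarrow>
    (\<exists>P\<in>relations \<PP>. \<forall>d d'. (d, d') \<in> P \<and> d \<in> dom h \<and> d' \<in> dom h \<longrightarrow> h d = h d')"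

definition mediator_family :: "('v \<Rightarrow> 'd \<rightharpoonup> 'a) \<Rightarrow> bool" where
  "mediator_family g \<longleftrightarrow> (\<forall>v v'. dom (g v) = dom (g v'))"

definition hat :: "('v \<Rightarrow> 'd \<rightharpoonup> 'a) \<Rightarrow> 'd \<rightharpoonup> ('v, 'a) store" where
  "hat g d = (if \<forall>v. d \<in> dom (g v) then Some (\<lambda>v. the (g v d)) else None)"

definition legal :: "('v \<Rightarrow> 'd qoi) \<Rightarrow> ('v \<Rightarrow> 'd \<rightharpoonup> 'a) \<Rightarrow> bool" where
  "legal \<sigma> g \<longleftrightarrow> (\<forall>v. mediates (g v) (\<sigma> v))"

text \<open>The projection \<open>\<pi>\<^sub>W\<close>, as an everywhere defined partial function\<close>

definition proj :: "'v set \<Rightarrow> ('v, 'a) store \<rightharpoonup> ('v, 'a) store" where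
  "proj W s = Some (restrict s W)"


section \<open>Type system\<close>

definition expr_type :: "('e \<Rightarrow> 'v::finite set) \<Rightarrow> 'e \<Rightarrow> ('v \<Rightarrow> 'm::comm_quantale) \<Rightarrow> 'm" where
  "expr_type fv E \<Gamma> = (\<Prod>v\<in>fv E. \<Gamma> v)"

definition if_env :: "'m \<Rightarrow> 'v set \<Rightarrow> ('v \<Rightarrow> 'm) \<Rightarrow> ('v \<Rightarrow> 'm) \<Rightarrow> ('v \<Rightarrow> 'm)
    \<Rightarrow> 'v \<Rightarrow> 'm::comm_quantale" where
  "if_env t X \<Gamma> \<Gamma>\<^sub>1 \<Gamma>\<^sub>2 = (\<lambda>x. if x \<in> X then t * sup (\<Gamma>\<^sub>1 x) (\<Gamma>\<^sub>2 x) else \<Gamma> x)"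

definition while_env :: "'m \<Rightarrow> 'v set \<Rightarrow> ('v \<Rightarrow> 'm) \<Rightarrow> 'v \<Rightarrow> 'm::comm_quantale" where
  "while_env t X \<Gamma> = (\<lambda>x. if x \<in> X then star t * \<Gamma> x else \<Gamma> x)"

inductive typing :: "('e \<Rightarrow> 'v::finite set) \<Rightarrow> 'm::comm_quantale \<Rightarrow> ('v \<Rightarrow> 'm) \<Rightarrow> ('v, 'e) com
    \<Rightarrow> ('v \<Rightarrow> 'm) \<Rightarrow> bool" for fv where
  Skip: "p \<in> above_one \<Longrightarrow> range \<Gamma> \<subseteq> above_one \<Longrightarrow> typing fv p \<Gamma> Skip \<Gamma>"
| Assign: "p \<in> above_one \<Longrightarrow> range \<Gamma> \<subseteq> above_one \<Longrightarrow>
    typing fv p \<Gamma> (Assign x E) (\<Gamma>(x := p * expr_type fv E \<Gamma>))"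
| Seq: "typing fv p \<Gamma> C\<^sub>1 \<Gamma>'' \<Longrightarrow> typing fv p \<Gamma>'' C\<^sub>2 \<Gamma>' \<Longrightarrow> typing fv p \<Gamma> (Seq C\<^sub>1 C\<^sub>2) \<Gamma>'"
| If: "p \<in> above_one \<Longrightarrow> t = expr_type fv E \<Gamma> \<Longrightarrow>
    typing fv (p * t) \<Gamma> C\<^sub>1 \<Gamma>\<^sub>1 \<Longrightarrow> typing fv (p * t) \<Gamma> C\<^sub>2 \<Gamma>\<^sub>2 \<Longrightarrow>
    typing fv p \<Gamma> (If E C\<^sub>1 C\<^sub>2) (if_env t (asgn C\<^sub>1 \<union> asgn C\<^sub>2) \<Gamma> \<Gamma>\<^sub>1 \<Gamma>\<^sub>2)"
| While: "p \<in> above_one \<Longrightarrow> t = expr_type fv E \<Gamma> \<Longrightarrow>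
    typing fv (p * t) \<Gamma> C \<Gamma> \<Longrightarrow>
    typing fv p \<Gamma> (While E C) (while_env t (asgn C) \<Gamma>)"
| Sub: "typing fv p \<Gamma> C \<Gamma>\<^sub>1 \<Longrightarrow> p' \<in> above_one \<Longrightarrow> range \<Gamma>' \<subseteq> above_one \<Longrightarrow>
    p' \<le> p \<Longrightarrow> \<Gamma>' \<le> \<Gamma> \<Longrightarrow> \<Gamma>\<^sub>1 \<le> \<Gamma>\<^sub>2 \<Longrightarrow> typing fv p' \<Gamma>' C \<Gamma>\<^sub>2"

text \<open>The algorithm reads the syntax-directed rules as equations. For a loop, the rule is
  applied to the least environment above \<open>\<Gamma>\<close> that is invariant under the body.\<close>

primrec alg :: "('e \<Rightarrow> 'v::finite set) \<Rightarrow> ('v, 'e) com \<Rightarrow> 'm::comm_quantale \<Rightarrow> ('v \<Rightarrow> 'm)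
    \<Rightarrow> 'v \<Rightarrow> 'm" where
  "alg fv Skip = (\<lambda>p \<Gamma>. \<Gamma>)"
| "alg fv (Assign x E) = (\<lambda>p \<Gamma>. \<Gamma>(x := p * expr_type fv E \<Gamma>))"
| "alg fv (Seq C\<^sub>1 C\<^sub>2) = (\<lambda>p \<Gamma>. alg fv C\<^sub>2 p (alg fv C\<^sub>1 p \<Gamma>))"
| "alg fv (If E C\<^sub>1 C\<^sub>2) = (\<lambda>p \<Gamma>. let t = expr_type fv E \<Gamma> in
    if_env t (asgn C\<^sub>1 \<union> asgn C\<^sub>2) \<Gamma> (alg fv C\<^sub>1 (p * t) \<Gamma>) (alg fv C\<^sub>2 (p * t) \<Gamma>))"
| "alg fv (While E C) = (\<lambda>p \<Gamma>.
    let \<Theta> = lfp (\<lambda>\<Theta>. sup \<Gamma> (alg fv C (p * expr_type fv E \<Theta>) \<Theta>))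
    in while_env (expr_type fv E \<Theta>) (asgn C) \<Theta>)"

definition Delta :: "('e \<Rightarrow> 'v::finite set) \<Rightarrow> ('v, 'e) com \<Rightarrow> 'v \<Rightarrow> 'v downset" where
  "Delta fv C = alg fv C 1 gen"

end

theory Submission
  imports Defs
begin

text \<open>Both variables end up with the value of \<open>v\<^sub>0\<close>. In the set object they get the same
  generator, which is idempotent, so specialising their tensor counts \<open>\<sigma> v\<^sub>0\<close> only once. A
  typing in \<open>M\<close> bounds each of them separately from below by \<open>\<sigma> v\<^sub>0\<close>, because subsumption can only
  raise the final environment; as the tensor is monotone, \<open>\<sigma> v\<^sub>0\<close> is then counted twice.\<close>

text \<open>Distributivity over the join of the pair \<open>{b, c}\<close>, which is
  \<open>c\<close>, makes \<open>a * c\<close> a join with \<open>a * b\<close> among its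
  members.\<close>

lemma comm_quantale_mult_left_mono:
  fixes a :: "'m::comm_quantale"
  assumes "b \<le> c"
  shows "a * b \<le> a * c"
proof -
  have "a * c = sup (a * b) (a * c)"
    using mult_Sup_distrib[of a "{b, c}"] assms by (simp add: sup.absorb2)
  then show ?thesis
    by (metis sup_ge1)
qed

lemma comm_quantale_mult_mono:
  fixes a :: "'m::comm_quantale"
  assumes "a \<le> b" "c \<le> d"
  shows "a * c \<le> b * d"
  using comm_quantale_mult_left_mono[OF assms(1), of c] comm_quantale_mult_left_mono[OF assms(2), of b]
  by (metis mult.commute order_trans)

lemma comm_quantale_prod_mono:
  fixes f g :: "'b \<Rightarrow> 'm::comm_quantale"
  assumes "\<And>x. x \<in> X \<Longrightarrow> f x \<le> g x"
  shows "prod f X \<le> prod g X"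
  using assms by (induction X rule: infinite_finite_induct) (auto intro: comm_quantale_mult_mono)

lemma expr_type_mono: "\<Gamma> \<le> \<Gamma>' \<Longrightarrow> expr_type fv E \<Gamma> \<le> expr_type fv E \<Gamma>'"
  unfolding expr_type_def by (intro comm_quantale_prod_mono) (simp add: le_fun_def)

text \<open>Provides the side condition of \<open>Sub\<close> for an intermediate environment, which
  is the initial environment of the second command of a sequence.\<close>

lemma typing_env_above_one:
  "typing fv p \<Gamma> C \<Gamma>' \<Longrightarrow> range \<Gamma> \<subseteq> above_one"
  by (induction rule: typing.induct) auto

text \<open>Inversion up to subsumption: the assignment rule gives equality, and each
  \<open>Sub\<close> only lowers the left side, by monotonicity of the tensor, and raises the right
  side.\<close>

lemma typing_AssignD:
  "typing fv p \<Gamma> (Assign x E) \<Gamma>' \<Longrightarrow> \<Gamma>(x := p * expr_type fv E \<Gamma>) \<le> \<Gamma>'"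
proof (induction p \<Gamma> "Assign x E" \<Gamma>' rule: typing.induct)
  case (Sub p \<Gamma> \<Gamma>\<^sub>1 p' \<Gamma>' \<Gamma>\<^sub>2)
  have "p' * expr_type fv E \<Gamma>' \<le> p * expr_type fv E \<Gamma>"
    using Sub by (intro comm_quantale_mult_mono expr_type_mono)
  then have "\<Gamma>'(x := p' * expr_type fv E \<Gamma>') \<le> \<Gamma>(x := p * expr_type fv E \<Gamma>)"
    using Sub by (simp add: le_fun_def)
  with Sub show ?case by (meson order_trans)
qed simp

text \<open>A final \<open>Sub\<close> can be pushed into the two halves with the same middle
  environment: the first half absorbs the lower initial environment, the second the higher final
  one, and both the lower \<open>p\<close>.\<close>

lemma typing_SeqE:
  assumes "typing fv p \<Gamma> (Seq C\<^sub>1 C\<^sub>2) \<Gamma>'"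
  obtains \<Gamma>'' where "typing fv p \<Gamma> C\<^sub>1 \<Gamma>''" "typing fv p \<Gamma>'' C\<^sub>2 \<Gamma>'"
proof -
  have "\<exists>\<Gamma>''. typing fv p \<Gamma> C\<^sub>1 \<Gamma>'' \<and> typing fv p \<Gamma>'' C\<^sub>2 \<Gamma>'"
    using assms
  proof (induction p \<Gamma> "Seq C\<^sub>1 C\<^sub>2" \<Gamma>' rule: typing.induct)
    case (Sub p \<Gamma> \<Gamma>\<^sub>1 p' \<Gamma>' \<Gamma>\<^sub>2)
    then obtain \<Gamma>'' where "typing fv p \<Gamma> C\<^sub>1 \<Gamma>''" and C2: "typing fv p \<Gamma>'' C\<^sub>2 \<Gamma>\<^sub>1" by blast
    then have "typing fv p' \<Gamma>' C\<^sub>1 \<Gamma>''"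
      using Sub by (meson typing.Sub order_refl)
    moreover have "typing fv p' \<Gamma>'' C\<^sub>2 \<Gamma>\<^sub>2"
      using typing.Sub[OF C2 _ typing_env_above_one[OF C2]] Sub by blast
    ultimately show ?case by blast
  qed blast
  with that show thesis by blast
qed

text \<open>Unions of subsets of \<open>{v}\<close> are again subsets of \<open>{v}\<close>. An
  arbitrary \<open>\<sigma> v\<close> need not be idempotent in this way.\<close>

lemma gen_mult_self: "gen v * gen v = gen v"
  by transfer (auto simp: down_def)

text \<open>The downset also contains the empty set; its empty product 1 is absorbed because it lies
  below \<open>\<sigma> v\<close>.\<close>

lemma specialise_gen:
  assumes "1 \<le> \<sigma> v"
  shows "specialise \<sigma> (gen v) = \<sigma> v"
proof -
  have "members (gen v) = {{}, {v}}"
    by (auto simp: gen.rep_eq down_def)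
  then show ?thesis
    using assms by (simp add: specialise_def sup.absorb2)
qed

text \<open>The relation that witnesses mediation for \<open>k\<close> also works for
  \<open>h\<close>, since \<open>h\<close> factors through \<open>k\<close> wherever it is
  defined.\<close>

lemma mediates_factor:
  assumes "mediates k \<PP>" "dom h \<subseteq> dom k"
    and "\<And>d d'. d \<in> dom h \<Longrightarrow> d' \<in> dom h \<Longrightarrow> k d = k d' \<Longrightarrow> h d = h d'"
  shows "mediates h \<PP>"
  using assms unfolding mediates_def by (meson subsetD)

context expressions
begin

text \<open>As \<open>u\<close> differs from \<open>v\<^sub>0\<close>, the second assignment still
  reads the initial value of \<open>v\<^sub>0\<close>.\<close>

lemma sem_C3:
  assumes "u \<noteq> v\<^sub>0"
  shows "sem eval tt (C3 var u w v\<^sub>0) s = Some (s(u := s v\<^sub>0, w := s v\<^sub>0))"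
  using assms by (simp add: C3_def eval_var map_comp_def)

lemma mediates_C3:
  assumes "legal \<sigma> g" "u \<noteq> v\<^sub>0"
  shows "mediates (proj {u, w} \<circ>\<^sub>m sem eval tt (C3 var u w v\<^sub>0) \<circ>\<^sub>m hat g) (\<sigma> v\<^sub>0)"
    (is "mediates ?h _")
proof (rule mediates_factor)
  \<comment> \<open>Where it is defined, the observation depends on \<open>d\<close> only through
    \<open>g v\<^sub>0 d\<close>.\<close>
  have h: "?h d = (if \<forall>v. d \<in> dom (g v) then Some (restrict (\<lambda>_. the (g v\<^sub>0 d)) {u, w}) else None)"
    for d
    by (auto simp: map_comp_def hat_def sem_C3[OF assms(2)] proj_def restrict_def)
  show "mediates (g v\<^sub>0) (\<sigma> v\<^sub>0)"
    using assms(1) by (simp add: legal_def)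
  show "dom ?h \<subseteq> dom (g v\<^sub>0)"
    by (auto simp: dom_def h split: if_splits)
  show "?h d = ?h d'" if "d \<in> dom ?h" "d' \<in> dom ?h" "g v\<^sub>0 d = g v\<^sub>0 d'" for d d'
  proof -
    have "?h e = Some (restrict (\<lambda>_. the (g v\<^sub>0 e)) {u, w})" if "e \<in> dom ?h" for e
      using that h[of e] by (metis domIff)
    with that show ?thesis by presburger
  qed
qed

end

lemma Delta_C3:
  assumes "fv (var v\<^sub>0) = {v\<^sub>0}" "u \<noteq> v\<^sub>0" "x \<in> {u, w}"
  shows "Delta fv (C3 var u w v\<^sub>0) x = gen v\<^sub>0"
  using assms by (auto simp: Delta_def C3_def expr_type_def)

lemma typing_C3:
  assumes "fv (var v\<^sub>0) = {v\<^sub>0}" "distinct [u, w, v\<^sub>0]" "x \<in> {u, w}"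
    and typing: "typing fv p \<Gamma> (C3 var u w v\<^sub>0) \<Gamma>'"
  shows "p * \<Gamma> v\<^sub>0 \<le> \<Gamma>' x"
proof -
  obtain \<Gamma>'' where "typing fv p \<Gamma> (Assign u (var v\<^sub>0)) \<Gamma>''" "typing fv p \<Gamma>'' (Assign w (var v\<^sub>0)) \<Gamma>'"
    using typing unfolding C3_def by (rule typing_SeqE)
  from this[THEN typing_AssignD] have
    "(\<Gamma>(u := p * \<Gamma> v\<^sub>0)) y \<le> \<Gamma>'' y" "(\<Gamma>''(w := p * \<Gamma>'' v\<^sub>0)) y \<le> \<Gamma>' y" for y
    unfolding le_fun_def by (simp_all add: expr_type_def assms(1))
  \<comment> \<open>The bound on \<open>u\<close> survives the second assignment because
    \<open>u\<close> and \<open>w\<close> differ; the one on \<open>w\<close> goes through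
    \<open>\<Gamma>'' v\<^sub>0\<close>, which the first assignment leaves above
    \<open>\<Gamma> v\<^sub>0\<close>.\<close>
  from this[of u] this[of w] this[of v\<^sub>0]
  have "p * \<Gamma> v\<^sub>0 \<le> \<Gamma>' u" "\<Gamma> v\<^sub>0 \<le> \<Gamma>'' v\<^sub>0" "p * \<Gamma>'' v\<^sub>0 \<le> \<Gamma>' w"
    using assms(2) by auto
  then show ?thesis
    using assms(3) comm_quantale_mult_left_mono order_trans by blast
qed

theorem theorem5:
  fixes eval :: "'e \<Rightarrow> ('v::finite, 'a) store \<Rightarrow> 'a"
    and fv :: "'e \<Rightarrow> 'v set"
    and var :: "'v \<Rightarrow> 'e"
    and tt :: "'a \<Rightarrow> bool"
    and \<sigma> :: "'v \<Rightarrow> 'd::finite qoi"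
    and u w v\<^sub>0 :: 'v
  assumes "expressions eval fv var"
    and "range \<sigma> \<subseteq> above_one"
    and "distinct [u, w, v\<^sub>0]"
    and "\<sigma> v\<^sub>0 * \<sigma> v\<^sub>0 \<noteq> \<sigma> v\<^sub>0"
  shows "(\<forall>g. mediator_family g \<and> legal \<sigma> g \<longrightarrow>
            mediates (proj {u, w} \<circ>\<^sub>m sem eval tt (C3 var u w v\<^sub>0) \<circ>\<^sub>m hat g) (\<sigma> v\<^sub>0))
       \<and> specialise \<sigma> (Delta fv (C3 var u w v\<^sub>0) u * Delta fv (C3 var u w v\<^sub>0) w) = \<sigma> v\<^sub>0
       \<and> (\<forall>\<Gamma>'. typing fv 1 \<sigma> (C3 var u w v\<^sub>0) \<Gamma>' \<longrightarrow> \<sigma> v\<^sub>0 * \<sigma> v\<^sub>0 \<le> \<Gamma>' u * \<Gamma>' w)"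
proof (intro conjI allI impI)
  interpret expressions eval fv var by fact
  have uv: "u \<noteq> v\<^sub>0" using assms(3) by simp
  show "mediates (proj {u, w} \<circ>\<^sub>m sem eval tt (C3 var u w v\<^sub>0) \<circ>\<^sub>m hat g) (\<sigma> v\<^sub>0)"
    if "mediator_family g \<and> legal \<sigma> g" for g
    using that uv by (intro mediates_C3) simp
  have "1 \<le> \<sigma> v\<^sub>0" using assms(2) by (auto simp: above_one_def)
  then show "specialise \<sigma> (Delta fv (C3 var u w v\<^sub>0) u * Delta fv (C3 var u w v\<^sub>0) w) = \<sigma> v\<^sub>0"
    by (simp add: Delta_C3[of fv var, OF fv_var uv] gen_mult_self specialise_gen)
  show "\<sigma> v\<^sub>0 * \<sigma> v\<^sub>0 \<le> \<Gamma>' u * \<Gamma>' w" if "typing fv 1 \<sigma> (C3 var u w v\<^sub>0) \<Gamma>'" for \<Gamma>'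
    using typing_C3[of fv var, OF fv_var assms(3) _ that] by (intro comm_quantale_mult_mono) auto
qed

end
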